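(* Let $\mathcal{T}=(t_{ijkl})$ be a real 4th-order $n$-dimensional symmetric tensor. Then $\mathcal{T}$ is positive definite if and only if both of the following hold: (a) for $x\in\mathbb{R}^n$, $\mathcal{T}x^4=0$ implies $x=0$; (b) there is a $y\in\mathbb{R}^n\setminus\{0\}$ such that $\mathcal{T}y^4>0$.
   Context: A 4th-order $n$-dimensional real tensor $\mathcal{T}=(t_{ijkl})_{1\le i,j,k,l\le n}$ is symmetric if its entries $t_{ijkl}$ are invariant under all permutations of the indices. For $x\in\mathbb{R}^n$, $\mathcal{T}x^4=\sum_{i,j,k,l=1}^n t_{ijkl}x_ix_jx_kx_l$. A symmetric tensor $\mathcal{T}$ is positive definite if $\mathcal{T}x^4>0$ for all $x\in\mathbb{R}^n\setminus\{0\}$. *)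

theory Defs
  imports "HOL-Analysis.Analysis"
begin

type_synonym 'n tensor4 = "real ^ 'n ^ 'n ^ 'n ^ 'n"

(* The function i :: nat => 'n is the multi-index (i 0, i 1, i 2, i 3);
   its values outside {..<4} play no role. *)
definition symmetric_tensor :: "'n::finite tensor4 \<Rightarrow> bool" where
  "symmetric_tensor T \<longleftrightarrow>
    (\<forall>(i :: nat \<Rightarrow> 'n) p. p permutes {..<4} \<longrightarrow>
      T $ i (p 0) $ i (p 1) $ i (p 2) $ i (p 3) = T $ i 0 $ i 1 $ i 2 $ i 3)"

definition tensor_form :: "'n::finite tensor4 \<Rightarrow> real ^ 'n \<Rightarrow> real" where
  "tensor_form T x =
    (\<Sum>i\<in>UNIV. \<Sum>j\<in>UNIV. \<Sum>k\<in>UNIV. \<Sum>l\<in>UNIV. T $ i $ j $ k $ l * x $ i * x $ j * x $ k * x $ l)"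

(* Meant for symmetric T; symmetry is not part of the definition and has to be
   assumed separately. *)
definition positive_definite :: "'n::finite tensor4 \<Rightarrow> bool" where
  "positive_definite T \<longleftrightarrow> (\<forall>x. x \<noteq> 0 \<longrightarrow> tensor_form T x > 0)"

end

theory Submission imports Defs
begin

text \<open>
  The quartic form of a tensor is continuous and homogeneous of degree 4. Suppose that it vanishes
  only at the origin, is positive at \<open>y\<close>, and is not positive at some \<open>x \<noteq> 0\<close>; then it is negative
  at \<open>x\<close>. By the intermediate value theorem it has a zero on the segment from \<open>x\<close> to \<open>y\<close>, and this
  zero must be the origin. So the segment passes through the origin, which makes \<open>y\<close> a multiple
  \<open>c x\<close>; but then the form at \<open>y\<close> is \<open>c\<^sup>4 \<ge> 0\<close> times its value at \<open>x\<close>, hence not positive.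
  Arguing on the segment itself, instead of on the connectedness of the punctured space, treats
  dimension one together with all others: there the evenness of the degree is all that matters.
\<close>

lemma tensor_form_scaleR: "tensor_form T (c *\<^sub>R x) = c ^ 4 * tensor_form T x"
  unfolding tensor_form_def
  by (simp add: sum_distrib_left power4_eq_xxxx mult_ac)

lemma continuous_on_tensor_form [continuous_intros]:
  assumes "continuous_on S g"
  shows "continuous_on S (\<lambda>s. tensor_form T (g s))"
  unfolding tensor_form_def by (intro continuous_intros assms)

text \<open>
  Scaling by a real factor cannot change the sign of a form of even degree, so \<open>x\<close> and \<open>y\<close> are not
  on one line through the origin, and the zero given by the intermediate value theorem is not
  the origin.
\<close>

lemma nonzero_root_of_sign_change:
  fixes T :: "'n::finite tensor4"
  assumes "tensor_form T x < 0" and "tensor_form T y > 0"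
  obtains z where "z \<noteq> 0" and "tensor_form T z = 0"
proof -
  define g where "g s = (1 - s) *\<^sub>R x + s *\<^sub>R y" for s :: real
  have "continuous_on {0..1} (\<lambda>s. tensor_form T (g s))"
    unfolding g_def by (intro continuous_intros)
  moreover have "tensor_form T (g 0) \<le> 0" and "0 \<le> tensor_form T (g 1)"
    using assms by (simp_all add: g_def)
  ultimately obtain s where root: "tensor_form T (g s) = 0"
    using IVT'[of "\<lambda>s. tensor_form T (g s)" 0 0 1] by auto
  have "g s \<noteq> 0"
  proof
    assume zero: "g s = 0"
    have "s \<noteq> 0"
      using root assms(1) by (auto simp: g_def)
    have "s *\<^sub>R y = (s - 1) *\<^sub>R x"
      using zero by (simp add: g_def algebra_simps add_eq_0_iff)
    then have "y = ((s - 1) / s) *\<^sub>R x"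
      using \<open>s \<noteq> 0\<close> by (metis (no_types) divide_inverse_commute scaleR_left_imp_eq scaleR_scaleR
          mult.assoc right_inverse mult_1)
    then have "tensor_form T y = ((s - 1) / s) ^ 4 * tensor_form T x"
      by (simp only: tensor_form_scaleR)
    also have "\<dots> \<le> 0"
      using assms(1) by (intro mult_nonneg_nonpos) auto
    finally show False
      using assms(2) by simp
  qed
  then show ?thesis
    using root that by blast
qed

theorem theorem4p1:
  fixes T :: "'n::finite tensor4"
  assumes "symmetric_tensor T"
  shows "positive_definite T \<longleftrightarrow>
    (\<forall>x. tensor_form T x = 0 \<longrightarrow> x = 0) \<and> (\<exists>y. y \<noteq> 0 \<and> tensor_form T y > 0)"
proof
  assume pd: "positive_definite T"
  have "(1 :: real ^ 'n) \<noteq> 0"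
    by (simp add: vec_eq_iff)
  with pd show "(\<forall>x. tensor_form T x = 0 \<longrightarrow> x = 0) \<and> (\<exists>y. y \<noteq> 0 \<and> tensor_form T y > 0)"
    unfolding positive_definite_def by (metis less_irrefl)
next
  assume "(\<forall>x. tensor_form T x = 0 \<longrightarrow> x = 0) \<and> (\<exists>y. y \<noteq> 0 \<and> tensor_form T y > 0)"
  then show "positive_definite T"
    unfolding positive_definite_def by (metis nonzero_root_of_sign_change linorder_neqE)
qed

end
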